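(* Let $h$ be the minimizer and $\mathscr L$ the liquid region described in the context, and on $\mathscr L$ let $\Upsilon,\Omega$ be the complex-valued functions given by $$\log\Upsilon=\pi\sigma_1(\nabla h)-i\pi h_y,\qquad \log\Omega=\pi\sigma_2(\nabla h)+i\pi h_x,$$ which satisfy $\Upsilon+\Omega\equiv1$. Let $f(z)=\overline{(I+\nabla\sigma)(\nabla h(z))}$. Then on $\mathscr L$ $$\mathcal H_\sigma'(f)=-\frac{i+(1-i)\Upsilon}{i-(1+i)\Upsilon}=-\frac{1+(i-1)\Omega}{-1+(1+i)\Omega}.$$ Furthermore, $$\Upsilon=e^{\frac\pi2(f-\mathcal H_\sigma(f))},\qquad \Omega=e^{i\frac\pi2(f+\mathcal H_\sigma(f))}.$$
   Context: $\mathbb R^2$ is identified with $\mathbb C$ ($z=x+iy$); gradients are viewed as complex numbers, and $I$ is the identity map. $N\subset\mathbb C$ is the closed triangle with vertices $0,1,i$, $N^\circ$ its interior, and for $s+it\in N$ $$\sigma(s,t)=-\frac1{\pi^2}\big(\Lambda(\pi s)+\Lambda(\pi t)+\Lambda(\pi(1-s-t))\big),\qquad \Lambda(\theta)=-\int_0^\theta\log|2\sin x|\,dx ;$$ $\sigma_1=\partial_s\sigma$, $\sigma_2=\partial_t\sigma$. Define $$\mathcal H_\sigma(z)=(I-\nabla\sigma)\circ(I+\nabla\sigma)^{-1}(\bar z),\qquad \mathrm{Dom}(\mathcal H_\sigma)=\{z\in\mathbb C:\bar z\in(I+\nabla\sigma)(N^\circ)\};$$ it is known that $\mathcal H_\sigma$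 is holomorphic on its domain, and $\mathcal H_\sigma'=\partial_z\mathcal H_\sigma$. Let $P\subset\mathbb R^2$ be a hexagon (or any bounded Lipschitz domain), $\mathscr A_N(P)=\{u\in C^{0,1}(\overline P):\nabla u(z)\in N\text{ for a.e. }z\in P\}$, $u_0\in\mathscr A_N(P)$, and $\mathscr A_N(P,u_0)=\{u\in\mathscr A_N(P):u=u_0\text{ on }\partial P\}$. $h$ is the unique minimizer over $\mathscr A_N(P,u_0)$ of $$I[u]=\int_P\sigma(\nabla u(z))\,dz+\int_Pw(z)u(z)\,dz,\qquad w(z)=\ln(q)\frac{\kappa^2q^{-S+2y-x}+1}{\kappa^2q^{-S+2y-x}-1},$$ with parameters $S,q,\kappa$ such that $w$ is real and has no singularity in $P$. The liquid region is $\mathscr L=\{z\in P:h\text{ is }C^1\text{ in a neighbourhood of }z\text{ and }\nabla h(z)\in N^\circ\}$. *)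

theory Defs
  imports "HOL-Analysis.Analysis"
begin

text \<open>The plane is identified with \<^typ>\<open>complex\<close>, and a gradient \<open>(u\<^sub>x, u\<^sub>y)\<close> is the
  complex number \<open>u\<^sub>x + i u\<^sub>y\<close>.\<close>

definition pdx :: "(complex \<Rightarrow> real) \<Rightarrow> complex \<Rightarrow> real" where
  "pdx u z = deriv (\<lambda>s. u (Complex s (Im z))) (Re z)"

definition pdy :: "(complex \<Rightarrow> real) \<Rightarrow> complex \<Rightarrow> real" where
  "pdy u z = deriv (\<lambda>t. u (Complex (Re z) t)) (Im z)"

definition grad :: "(complex \<Rightarrow> real) \<Rightarrow> complex \<Rightarrow> complex" where
  "grad u z = Complex (pdx u z) (pdy u z)"

text \<open>Where \<open>u\<close> is differentiable, this is the gradient of the library.\<close>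

lemma GDERIV_imp_grad:
  fixes u :: "complex \<Rightarrow> real"
  assumes "GDERIV u z :> D"
  shows "grad u z = D"
proof -
  have D: "(u has_derivative (\<lambda>h. inner h D)) (at z)"
    using assms by (simp add: gderiv_def)
  have hx: "((\<lambda>s. Complex s (Im z)) has_derivative (\<lambda>s. Complex s 0)) (at (Re z))"
    by (auto simp: Complex_eq intro!: derivative_eq_intros)
  have hy: "((\<lambda>t. Complex (Re z) t) has_derivative (\<lambda>t. Complex 0 t)) (at (Im z))"
    by (auto simp: Complex_eq intro!: derivative_eq_intros)
  have "((\<lambda>s. u (Complex s (Im z))) has_derivative (\<lambda>s. inner (Complex s 0) D)) (at (Re z))"
    using has_derivative_compose[OF hx, of u] D by simp
  then have "((\<lambda>s. u (Complex s (Im z))) has_field_derivative Re D) (at (Re z))"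
    by (simp add: has_field_derivative_def inner_complex_def mult_commute_abs)
  moreover have "((\<lambda>t. u (Complex (Re z) t)) has_derivative (\<lambda>t. inner (Complex 0 t) D)) (at (Im z))"
    using has_derivative_compose[OF hy, of u] D by simp
  then have "((\<lambda>t. u (Complex (Re z) t)) has_field_derivative Im D) (at (Im z))"
    by (simp add: has_field_derivative_def inner_complex_def mult_commute_abs)
  ultimately show ?thesis
    by (simp add: grad_def pdx_def pdy_def DERIV_imp_deriv)
qed

definition triangle_N :: "complex set" where
  "triangle_N = convex hull {0, 1, \<i>}"

text \<open>The interval integral is oriented, so \<open>lobachevsky\<close> is defined for \<open>\<theta> < 0\<close> as well.\<close>

definition lobachevsky :: "real \<Rightarrow> real" where
  "lobachevsky \<theta> = - (LBINT x=0..\<theta>. ln \<bar>2 * sin x\<bar>)"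

definition surface_tension :: "complex \<Rightarrow> real" where
  "surface_tension z = - (1 / pi\<^sup>2) *
     (lobachevsky (pi * Re z) + lobachevsky (pi * Im z) + lobachevsky (pi * (1 - Re z - Im z)))"

text \<open>\<open>H_sigma\<close> is meaningful on \<open>H_sigma_dom\<close> only.\<close>

definition H_sigma :: "complex \<Rightarrow> complex" where
  "H_sigma z =
     (let p = the_inv_into (interior triangle_N) (\<lambda>p. p + grad surface_tension p) (cnj z)
      in p - grad surface_tension p)"

definition H_sigma_dom :: "complex set" where
  "H_sigma_dom = {z. cnj z \<in> (\<lambda>p. p + grad surface_tension p) ` interior triangle_N}"

text \<open>Near each boundary point \<open>p\<close> the domain is, in coordinates translated to \<open>p\<close> and rotated
  by the unit number \<open>c\<close>, the part of the plane above the graph of a Lipschitz function.\<close>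

definition bounded_lipschitz_domain :: "complex set \<Rightarrow> bool" where
  "bounded_lipschitz_domain P \<longleftrightarrow>
     open P \<and> connected P \<and> bounded P \<and>
     (\<forall>p\<in>frontier P. \<exists>c r L. \<exists>g :: real \<Rightarrow> real.
        norm c = 1 \<and> r > 0 \<and> L-lipschitz_on UNIV g \<and>
        P \<inter> ball p r = {z \<in> ball p r. Im ((z - p) / c) > g (Re ((z - p) / c))})"

text \<open>Functions on the closure of \<open>P\<close> are total functions whose values elsewhere are irrelevant.
  By Rademacher's theorem differentiability almost everywhere follows from the Lipschitz condition;
  it is spelled out because \<^const>\<open>grad\<close> is meaningful only at points of differentiability.\<close>

definition admissible :: "complex set \<Rightarrow> (complex \<Rightarrow> real) set" where
  "admissible P = {u. (\<exists>L. L-lipschitz_on (closure P) u) \<and>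
     (AE z in lebesgue. z \<in> P \<longrightarrow> u differentiable (at z) \<and> grad u z \<in> triangle_N)}"

definition admissible_bdry :: "complex set \<Rightarrow> (complex \<Rightarrow> real) \<Rightarrow> (complex \<Rightarrow> real) set" where
  "admissible_bdry P u0 = {u \<in> admissible P. \<forall>z\<in>frontier P. u z = u0 z}"

definition qvol_denom :: "real \<Rightarrow> complex \<Rightarrow> complex \<Rightarrow> complex \<Rightarrow> complex" where
  "qvol_denom S q \<kappa> z = \<kappa>\<^sup>2 * q powr of_real (- S + 2 * Im z - Re z) - 1"

text \<open>The parameters \<open>q\<close> and \<open>\<kappa>\<close> may be complex: only the resulting weight has to be real.\<close>

definition qvol_weight :: "real \<Rightarrow> complex \<Rightarrow> complex \<Rightarrow> complex \<Rightarrow> complex" where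
  "qvol_weight S q \<kappa> z =
     Ln q * ((\<kappa>\<^sup>2 * q powr of_real (- S + 2 * Im z - Re z) + 1) / qvol_denom S q \<kappa> z)"

definition energy :: "complex set \<Rightarrow> (complex \<Rightarrow> real) \<Rightarrow> (complex \<Rightarrow> real) \<Rightarrow> real" where
  "energy P w u = (LINT z:P|lebesgue. surface_tension (grad u z)) + (LINT z:P|lebesgue. w z * u z)"

text \<open>Uniqueness is up to the irrelevant values outside the closure of \<open>P\<close>.\<close>

definition unique_minimizer ::
    "complex set \<Rightarrow> (complex \<Rightarrow> real) \<Rightarrow> (complex \<Rightarrow> real) \<Rightarrow> (complex \<Rightarrow> real) \<Rightarrow> bool" where
  "unique_minimizer P u0 w h \<longleftrightarrow>
     h \<in> admissible_bdry P u0 \<and>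
     (\<forall>u\<in>admissible_bdry P u0. energy P w h \<le> energy P w u \<and>
        (energy P w u = energy P w h \<longrightarrow> (\<forall>z\<in>closure P. u z = h z)))"

definition C1_near :: "(complex \<Rightarrow> real) \<Rightarrow> complex \<Rightarrow> bool" where
  "C1_near u z \<longleftrightarrow>
     (\<exists>U. open U \<and> z \<in> U \<and> (\<forall>v\<in>U. u differentiable (at v)) \<and> continuous_on U (grad u))"

definition liquid_region :: "complex set \<Rightarrow> (complex \<Rightarrow> real) \<Rightarrow> complex set" where
  "liquid_region P h = {z \<in> P. C1_near h z \<and> grad h z \<in> interior triangle_N}"

text \<open>In the liquid region the exponents below have imaginary part in \<open>(-\<pi>, \<pi>)\<close>, so they are the
  principal logarithms of \<open>Upsilon\<close> and \<open>Omega_fun\<close>.\<close>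

definition Upsilon :: "(complex \<Rightarrow> real) \<Rightarrow> complex \<Rightarrow> complex" where
  "Upsilon h z = exp (of_real (pi * pdx surface_tension (grad h z)) - \<i> * of_real (pi * pdy h z))"

definition Omega_fun :: "(complex \<Rightarrow> real) \<Rightarrow> complex \<Rightarrow> complex" where
  "Omega_fun h z = exp (of_real (pi * pdy surface_tension (grad h z)) + \<i> * of_real (pi * pdx h z))"

definition f_map :: "(complex \<Rightarrow> real) \<Rightarrow> complex \<Rightarrow> complex" where
  "f_map h z = cnj (grad h z + grad surface_tension (grad h z))"

end

theory Submission
  imports Defs "HOL-Real_Asymp.Real_Asymp"
begin

text \<open>
  Everything happens at a single gradient \<open>p = s + i t\<close> in the interior of the triangle. The
  derivative of the Lobachevsky function being \<open>- ln (2 sin \<theta>)\<close>, the gradient of \<open>\<sigma>\<close> consists of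
  logarithms of quotients of sines, which gives \<open>\<Upsilon> = (Z - i) / (X + Z)\<close> and \<open>\<Omega> = (X + i) / (X + Z)\<close>
  for \<open>X = cot (\<pi> s)\<close> and \<open>Z = cot (\<pi> t)\<close>. The Hessian \<open>A\<close> of \<open>\<sigma>\<close> is a rational function of \<open>X\<close>
  and \<open>Z\<close>; it is positive definite of determinant one. Positivity makes \<open>I + \<nabla>\<sigma>\<close> injective with
  invertible derivative, and determinant one makes \<open>v - A v\<close> a fixed complex multiple of the
  conjugate of \<open>v + A v\<close>; that factor is the derivative of \<open>H\<^sub>\<sigma>\<close>.
\<close>

section \<open>Integrability and derivative of the Lobachevsky function\<close>

text \<open>The derivative \<open>2 * cos y - 1\<close> of the difference is nonnegative since
  \<open>1 < pi / 3\<close>. The bound controls the logarithmic singularity at 0.\<close>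

lemma sin_ge_half:
  fixes x :: real
  assumes "0 \<le> x" "x \<le> 1"
  shows "x \<le> 2 * sin x"
proof -
  have "2 * sin 0 - 0 \<le> 2 * sin x - x"
  proof (rule DERIV_nonneg_imp_nondecreasing[of 0 x "\<lambda>x. 2 * sin x - x"])
    show "0 \<le> x" by fact
    fix y :: real assume y: "0 \<le> y" "y \<le> x"
    have "cos (pi / 3) \<le> cos y"
      using y assms pi_gt3 by (intro cos_monotone_0_pi_le) auto
    then show "\<exists>d. ((\<lambda>x. 2 * sin x - x) has_real_derivative d) (at y) \<and> 0 \<le> d"
      by (intro exI[of _ "2 * cos y - 1"]) (auto simp: cos_60 intro!: derivative_eq_intros)
  qed
  then show ?thesis by simp
qed

text \<open>This is the dominating function for the logarithm of the sine. Its antiderivative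
  \<open>F\<close> has finite limits at both ends, at 0 because \<open>x * ln x\<close> tends to
  0.\<close>

lemma set_integrable_const_minus_ln:
  "set_integrable lborel {0<..<1} (\<lambda>x::real. ln 2 - ln x)"
proof -
  define F :: "real \<Rightarrow> real" where "F = (\<lambda>x. x * ln 2 - x * ln x + x)"
  have "set_integrable lborel (einterval (ereal 0) (ereal 1)) (\<lambda>x::real. ln 2 - ln x)"
  proof (rule interval_integral_FTC_nonneg(1)[where F = F])
    show "((F \<circ> real_of_ereal) \<longlongrightarrow> 0) (at_right (ereal 0))"
      unfolding F_def ereal_tendsto_simps by real_asymp
    show "((F \<circ> real_of_ereal) \<longlongrightarrow> ln 2 + 1) (at_left (ereal 1))"
      unfolding F_def ereal_tendsto_simps by (auto intro!: tendsto_eq_intros)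
    show "AE x in lborel. ereal 0 < ereal x \<longrightarrow> ereal x < ereal 1 \<longrightarrow> 0 \<le> ln 2 - ln x"
      by (intro AE_I2) (auto simp: ln_le_cancel_iff)
  next
    fix x assume x: "ereal 0 < ereal x" "ereal x < ereal 1"
    show "(F has_real_derivative ln 2 - ln x) (at x)"
      unfolding F_def using x by (auto intro!: derivative_eq_intros)
    show "isCont (\<lambda>x. ln 2 - ln x) x"
      using x by (auto intro!: continuous_intros)
  qed simp
  then show ?thesis by simp
qed

lemma set_integrable_ln_sin:
  "set_integrable lborel {0<..<1} (\<lambda>x::real. ln \<bar>2 * sin x\<bar>)"
proof (rule set_integrable_bound[OF set_integrable_const_minus_ln])
  show "set_borel_measurable lborel {0<..<1::real} (\<lambda>x. ln \<bar>2 * sin x\<bar>)"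
    unfolding set_borel_measurable_def by measurable
  have "\<bar>ln \<bar>2 * sin x\<bar>\<bar> \<le> \<bar>ln 2 - ln x\<bar>" if "0 < x" "x < 1" for x :: real
  proof -
    have s: "x \<le> 2 * sin x" using that by (intro sin_ge_half) auto
    then have "ln x \<le> ln (2 * sin x)" "ln (2 * sin x) \<le> ln 2" "\<bar>2 * sin x\<bar> = 2 * sin x"
      using that by (auto simp: ln_le_cancel_iff)
    moreover have "ln x < 0" "0 < ln (2::real)" using that by auto
    ultimately show ?thesis by linarith
  qed
  then show "AE x in lborel. x \<in> {0<..<1} \<longrightarrow> norm (ln \<bar>2 * sin x\<bar>) \<le> norm (ln 2 - ln x :: real)"
    by (intro AE_I2) auto
qed

lemma DERIV_lobachevsky:
  assumes "0 < \<theta>" "\<theta> < pi"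
  shows "(lobachevsky has_real_derivative - ln (2 * sin \<theta>)) (at \<theta>)"
proof -
  define g :: "real \<Rightarrow> real" where "g = (\<lambda>x. ln \<bar>2 * sin x\<bar>)"
  \<comment> \<open>The singularity of the integrand at 0 is separated from \<open>\<theta>\<close> by splitting the integral at \<open>c\<close>.\<close>
  define c where "c = min (1/2) (\<theta> / 2)"
  define b where "b = (\<theta> + pi) / 2"
  have c: "0 < c" "c < \<theta>" "c < 1" and b: "\<theta> < b" "b < pi"
    using assms by (auto simp: c_def b_def)
  have cont: "continuous_on {c..b} g"
  proof -
    have "sin x \<noteq> 0" if "x \<in> {c..b}" for x
      using that c b sin_gt_zero[of x] by auto
    then show ?thesis unfolding g_def by (intro continuous_intros) auto
  qed
  have split: "(LBINT x=0..u. g x) = (LBINT x=0..c. g x) + (LBINT x=c..u. g x)"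
    if "u \<in> {c<..<b}" for u
  proof -
    \<comment> \<open>Near 0 integrability comes from \<open>set_integrable_ln_sin\<close>, as
      \<open>c < 1\<close>; on \<open>{c..b}\<close>, which stays away from 0 and \<pi>, it comes
      from continuity.\<close>
    have "set_integrable lborel ({0<..<1} \<inter> {0<..<c} \<union> {c..b}) g"
      unfolding g_def
      by (intro set_integrable_Un set_integrable_subset[OF set_integrable_ln_sin]
            borel_integrable_atLeastAtMost' cont[unfolded g_def]) auto
    then have "set_integrable lborel (einterval (ereal 0) (ereal u)) g"
      by (rule set_integrable_subset) (use that c in auto)
    then have "interval_lebesgue_integrable lborel (min 0 (min (ereal c) (ereal u)))
        (max 0 (max (ereal c) (ereal u))) g"
      using that c by (simp add: interval_lebesgue_integrable_def min_def max_def zero_ereal_def)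
    from interval_integral_sum[OF this] show ?thesis by simp
  qed
  have "((\<lambda>u. LBINT x=c..u. g x) has_vector_derivative g \<theta>) (at \<theta> within {c..b})"
    by (rule interval_integral_FTC2[OF _ _ cont]) (use b c in auto)
  then have "((\<lambda>u. LBINT x=c..u. g x) has_real_derivative g \<theta>) (at \<theta>)"
    using at_within_Icc_at[of c \<theta> b] b c by (simp add: has_real_derivative_iff_has_vector_derivative)
  then have "((\<lambda>u. - ((LBINT x=0..c. g x) + (LBINT x=c..u. g x))) has_real_derivative - g \<theta>) (at \<theta>)"
    by (auto intro!: derivative_eq_intros)
  then have "(lobachevsky has_real_derivative - g \<theta>) (at \<theta>)"
  proof (rule has_field_derivative_transform_within_open)
    show "- ((LBINT x=0..c. g x) + (LBINT x=c..u. g x)) = lobachevsky u" if "u \<in> {c<..<b}" for u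
      by (simp add: lobachevsky_def split[OF that, unfolded g_def] g_def)
  qed (use b c in auto)
  then show ?thesis
    using sin_gt_zero[OF assms] by (simp add: g_def)
qed

section \<open>The triangle and the gradient of the surface tension\<close>

text \<open>Each edge confines the triangle to a closed half-plane, and passing to interiors makes
  the inequality strict.\<close>

lemma interior_triangle_N_D:
  assumes "p \<in> interior triangle_N"
  shows "0 < Re p" "0 < Im p" "Re p + Im p < 1"
proof -
  have strict: "a \<bullet> p < b" if "a \<noteq> 0" "0 \<le> b" "Re a \<le> b" "Im a \<le> b" for a b
  proof -
    have "triangle_N \<subseteq> {z. a \<bullet> z \<le> b}"
      unfolding triangle_N_def using that
      by (intro hull_minimal convex_halfspace_le) (auto simp: inner_complex_def)
    from interior_mono[OF this] assms show ?thesis using that(1) by auto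
  qed
  show "0 < Re p" using strict[of "-1" 0] by (auto simp: inner_complex_def)
  show "0 < Im p" using strict[of "-\<i>" 0] by (auto simp: inner_complex_def)
  show "Re p + Im p < 1" using strict[of "Complex 1 1" 1] by (auto simp: inner_complex_def complex_eq_iff)
qed

lemma interior_triangle_N_sin_pos:
  assumes "p \<in> interior triangle_N"
  shows "0 < sin (pi * Re p)" "0 < sin (pi * Im p)" "0 < sin (pi * (Re p + Im p))"
  using interior_triangle_N_D[OF assms] by (auto intro!: sin_gt_zero)

text \<open>Each variable enters two Lobachevsky terms with opposite signs, so their
  \<open>ln 2\<close> contributions cancel; the sine in the third term is reflected by
  \<open>sin (pi - x) = sin x\<close>.\<close>

lemma pd_surface_tension:
  assumes "p \<in> interior triangle_N"
  shows "pdx surface_tension p = (ln (sin (pi * Re p)) - ln (sin (pi * (Re p + Im p)))) / pi"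
    and "pdy surface_tension p = (ln (sin (pi * Im p)) - ln (sin (pi * (Re p + Im p)))) / pi"
proof -
  note p = interior_triangle_N_D[OF assms] and pos = interior_triangle_N_sin_pos[OF assms]
  have "sin (pi * (1 - Re p - Im p)) = sin (pi - pi * (Re p + Im p))" by (simp add: algebra_simps)
  then have s: "sin (pi * (1 - Re p - Im p)) = sin (pi * (Re p + Im p))" by (simp only: sin_pi_minus)
  note L = DERIV_chain2[OF DERIV_lobachevsky]
  have "((\<lambda>s. surface_tension (Complex s (Im p))) has_real_derivative
     (ln (sin (pi * Re p)) - ln (sin (pi * (Re p + Im p)))) / pi) (at (Re p))"
    unfolding surface_tension_def complex.sel
    by (rule derivative_eq_intros L refl | use p pos in \<open>force simp: mult_less_cancel_left1\<close>)+
       (use pos in \<open>simp add: s ln_mult field_simps power2_eq_square\<close>)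
  then show "pdx surface_tension p = (ln (sin (pi * Re p)) - ln (sin (pi * (Re p + Im p)))) / pi"
    unfolding pdx_def by (rule DERIV_imp_deriv)
  have "((\<lambda>t. surface_tension (Complex (Re p) t)) has_real_derivative
     (ln (sin (pi * Im p)) - ln (sin (pi * (Re p + Im p)))) / pi) (at (Im p))"
    unfolding surface_tension_def complex.sel
    by (rule derivative_eq_intros L refl | use p pos in \<open>force simp: mult_less_cancel_left1\<close>)+
       (use pos in \<open>simp add: s ln_mult field_simps power2_eq_square\<close>)
  then show "pdy surface_tension p = (ln (sin (pi * Im p)) - ln (sin (pi * (Re p + Im p)))) / pi"
    unfolding pdy_def by (rule DERIV_imp_deriv)
qed

section \<open>Positivity and determinant of the Hessian\<close>

text \<open>The Hessian of \<open>\<sigma>\<close> at \<open>s + i t\<close>, as a linear map, when \<open>X = cot (\<pi> s)\<close> and \<open>Z = cot (\<pi> t)\<close>.\<close>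

definition hess :: "real \<Rightarrow> real \<Rightarrow> complex \<Rightarrow> complex" where
  "hess X Z v = Complex (((X\<^sup>2 + 1) * Re v + (1 - X * Z) * Im v) / (X + Z))
                        (((1 - X * Z) * Re v + (Z\<^sup>2 + 1) * Im v) / (X + Z))"

text \<open>Completing squares writes the form as a sum of two squares over \<open>X + Z\<close>. If
  both vanish then \<open>Im v = - Re v\<close>, hence \<open>(X + Z) * Re v = 0\<close>.\<close>

lemma inner_hess_pos:
  assumes "0 < X + Z" "v \<noteq> 0"
  shows "0 < v \<bullet> hess X Z v"
proof -
  have "v \<bullet> hess X Z v = ((X * Re v - Z * Im v)\<^sup>2 + (Re v + Im v)\<^sup>2) / (X + Z)"
    by (simp add: inner_complex_def hess_def add_divide_distrib[symmetric] power2_eq_square algebra_simps)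
  moreover have "0 < (X * Re v - Z * Im v)\<^sup>2 + (Re v + Im v)\<^sup>2"
  proof (rule ccontr)
    assume "\<not> ?thesis"
    then have 0: "X * Re v - Z * Im v = 0" "Re v + Im v = 0"
      by (auto simp: sum_power2_gt_zero_iff)
    then have "(X + Z) * Re v = 0" by algebra
    with 0 assms show False by (auto simp: complex_eq_iff)
  qed
  ultimately show ?thesis using assms by simp
qed

lemma linear_hess: "linear (hess X Z)"
  by (rule linearI) (auto simp: hess_def complex_eq_iff add_divide_distrib diff_divide_distrib ring_distribs mult_ac)

text \<open>Multiplied by \<open>X + Z\<close> the expression becomes
  \<open>- (Z + 1) + \<i> * (X + 1)\<close>, which vanishes only for
  \<open>X = Z = -1\<close>.\<close>

lemma hess_denominator_nonzero:
  fixes X Z :: real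
  assumes "0 < X + Z" and Y: "Y = (of_real Z - \<i>) / of_real (X + Z)"
  shows "\<i> - (1 + \<i>) * Y \<noteq> 0"
proof
  assume "\<i> - (1 + \<i>) * Y = 0"
  moreover have "Y * of_real (X + Z) = of_real Z - \<i>" using assms by (simp flip: of_real_add)
  ultimately have "\<i> * of_real (X + Z) - (1 + \<i>) * (of_real Z - \<i>) = 0" by algebra
  then have "Z + 1 = 0" "X + 1 = 0" by (auto simp: complex_eq_iff)
  with assms show False by simp
qed

text \<open>A symmetric real matrix acts as \<open>\<alpha> * v + \<beta> * cnj v\<close> with
  \<alpha> real, and determinant one reads
  \<open>\<alpha>\<^sup>2 - (cmod \<beta>)\<^sup>2 = 1\<close>. This is exactly what makes the two
  sides proportional, with factor \<open>- \<beta> / (1 + \<alpha>)\<close>. The parameter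
  \<open>Y\<close> will be the value of \<open>Upsilon\<close>.\<close>

lemma hess_ratio:
  fixes X Z :: real
  assumes "0 < X + Z" and Y: "Y = (of_real Z - \<i>) / of_real (X + Z)"
  shows "v - hess X Z v = - ((\<i> + (1 - \<i>) * Y) / (\<i> - (1 + \<i>) * Y)) * cnj (v + hess X Z v)"
proof -
  define T where "T = X + Z"
  have T: "T \<noteq> 0" "X = T - Z" using assms by (auto simp: T_def)
  have "(\<i> - (1 + \<i>) * Y) * (v - hess X Z v) = - (\<i> + (1 - \<i>) * Y) * cnj (v + hess X Z v)"
    using T(1) unfolding Y hess_def T_def[symmetric] T(2)
    by (simp add: complex_eq_iff field_simps power2_eq_square)
  then show ?thesis
    using hess_denominator_nonzero[OF assms] by (simp add: field_simps)
qed

section \<open>Differentiating the gradient of the surface tension\<close>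

text \<open>The first identity yields the positivity of \<open>X + Z\<close>; the second makes the
  Hessian entries rational in \<open>X\<close> and \<open>Z\<close>.\<close>

lemma cot_add:
  fixes a b :: real
  assumes "sin a \<noteq> 0" "sin b \<noteq> 0"
  shows "cot a + cot b = sin (a + b) / (sin a * sin b)"
    and "cot (a + b) = (cot a * cot b - 1) / (cot a + cot b)"
proof -
  show sum: "cot a + cot b = sin (a + b) / (sin a * sin b)"
    using assms by (simp add: cot_def sin_add field_simps)
  have "cot a * cot b - 1 = cos (a + b) / (sin a * sin b)"
    using assms by (simp add: cot_def cos_add field_simps)
  then show "cot (a + b) = (cot a * cot b - 1) / (cot a + cot b)"
    unfolding sum using assms by (simp add: cot_def)
qed

lemma interior_triangle_N_cot_pos:
  assumes "p \<in> interior triangle_N"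
  shows "0 < cot (pi * Re p) + cot (pi * Im p)"
  using interior_triangle_N_sin_pos[OF assms] by (simp add: cot_add distrib_left)

lemma has_derivative_grad_surface_tension:
  assumes "p \<in> interior triangle_N"
  shows "(grad surface_tension has_derivative hess (cot (pi * Re p)) (cot (pi * Im p))) (at p)"
proof -
  note pos = interior_triangle_N_sin_pos[OF assms]
  define X Z where "X = cot (pi * Re p)" and "Z = cot (pi * Im p)"
  have T: "0 < X + Z" using interior_triangle_N_cot_pos[OF assms] by (simp add: X_def Z_def)
  have cot_eq: "cos x / sin x = cot x" for x :: real by (simp add: cot_def)
  have C: "cos (pi * (Re p + Im p)) / sin (pi * (Re p + Im p)) = (X * Z - 1) / (X + Z)"
    using cot_add(2)[of "pi * Re p" "pi * Im p"] pos
    by (simp add: X_def Z_def distrib_left cot_eq)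
  have D: "((\<lambda>v. ln (sin (pi * Re v))) has_derivative (\<lambda>v. pi * X * Re v)) (at p)"
    "((\<lambda>v. ln (sin (pi * Im v))) has_derivative (\<lambda>v. pi * Z * Im v)) (at p)"
    "((\<lambda>v. ln (sin (pi * (Re v + Im v)))) has_derivative
       (\<lambda>v. pi * ((X * Z - 1) / (X + Z)) * (Re v + Im v))) (at p)"
    unfolding C[symmetric] unfolding X_def Z_def cot_def
    by (rule derivative_eq_intros refl pos | force simp: field_simps)+
  \<comment> \<open>\<open>G\<close> is the explicit formula for the gradient. It agrees with
    \<open>grad surface_tension\<close> on the open interior, so its derivative at \<open>p\<close>
    carries over.\<close>
  define G where "G = (\<lambda>v. of_real ((ln (sin (pi * Re v)) - ln (sin (pi * (Re v + Im v)))) / pi)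
    + \<i> * of_real ((ln (sin (pi * Im v)) - ln (sin (pi * (Re v + Im v)))) / pi))"
  let ?c = "\<lambda>v. pi * ((X * Z - 1) / (X + Z)) * (Re v + Im v)"
  have "(G has_derivative (\<lambda>v. of_real ((pi * X * Re v - ?c v) / pi)
      + \<i> * of_real ((pi * Z * Im v - ?c v) / pi))) (at p)"
    unfolding G_def
    by (intro has_derivative_add has_derivative_mult_right has_derivative_of_real
          has_derivative_diff D bounded_linear.has_derivative[OF bounded_linear_divide])
  also have "(\<lambda>v. of_real ((pi * X * Re v - ?c v) / pi)
      + \<i> * of_real ((pi * Z * Im v - ?c v) / pi)) = hess X Z"
  proof
    fix v
    have "(pi * x - pi * k * y) / pi = x - k * y" for x k y by (simp add: field_simps)
    then have "(pi * X * Re v - ?c v) / pi = X * Re v - (X * Z - 1) / (X + Z) * (Re v + Im v)"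
      "(pi * Z * Im v - ?c v) / pi = Z * Im v - (X * Z - 1) / (X + Z) * (Re v + Im v)"
      by (metis mult.assoc)+
    then show "of_real ((pi * X * Re v - ?c v) / pi) + \<i> * of_real ((pi * Z * Im v - ?c v) / pi)
        = hess X Z v"
      using T by (auto simp: hess_def complex_eq_iff field_simps power2_eq_square)
  qed
  finally have "(G has_derivative hess X Z) (at p)" .
  then show ?thesis
    unfolding X_def Z_def
    by (rule has_derivative_transform_within_open[where s = "interior triangle_N"])
       (use assms in \<open>auto simp: G_def grad_def pd_surface_tension Complex_eq\<close>)
qed

section \<open>Injectivity and the derivative of \<open>H_sigma\<close>\<close>

text \<open>The map is strictly monotone: on the segment from \<open>p\<close> to \<open>q\<close>,
  which stays in the interior by convexity, its inner product with \<open>d\<close> has derivative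
  \<open>d \<bullet> (d + A d) > 0\<close>. Equal values at the ends would give
  \<open>\<phi> 0 = \<phi> 1\<close>.\<close>

lemma inj_on_id_plus_grad_surface_tension:
  "inj_on (\<lambda>p. p + grad surface_tension p) (interior triangle_N)"
proof (rule inj_onI, rule ccontr)
  fix p q
  assume pq: "p \<in> interior triangle_N" "q \<in> interior triangle_N" "p \<noteq> q"
    and eq: "p + grad surface_tension p = q + grad surface_tension q"
  define d where "d = q - p"
  define l where "l = (\<lambda>t. p + t *\<^sub>R d)"
  define \<phi> where "\<phi> = (\<lambda>t. d \<bullet> (l t + grad surface_tension (l t)))"
  have "\<phi> 0 < \<phi> 1"
  proof (rule DERIV_pos_imp_increasing[of 0 1 \<phi>])
    fix t :: real assume t: "0 \<le> t" "t \<le> 1"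
    have "convex (interior triangle_N)" by (simp add: triangle_N_def convex_interior)
    then have "(1 - t) *\<^sub>R p + t *\<^sub>R q \<in> interior triangle_N" using pq t by (simp add: convex_alt)
    then have lt: "l t \<in> interior triangle_N" by (simp add: l_def d_def algebra_simps)
    define A where "A = hess (cot (pi * Re (l t))) (cot (pi * Im (l t)))"
    have lD: "(l has_derivative (\<lambda>s. s *\<^sub>R d)) (at t)"
      unfolding l_def by (auto intro!: derivative_eq_intros)
    have "((\<lambda>t. grad surface_tension (l t)) has_derivative (\<lambda>s. A (s *\<^sub>R d))) (at t)"
      using has_derivative_compose[OF lD has_derivative_grad_surface_tension[OF lt]] by (simp add: A_def)
    then have "(\<phi> has_derivative (\<lambda>s. d \<bullet> (s *\<^sub>R d + A (s *\<^sub>R d)))) (at t)"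
      unfolding \<phi>_def by (intro has_derivative_inner_right has_derivative_add lD)
    then have "(\<phi> has_real_derivative d \<bullet> (d + A d)) (at t)"
      by (simp add: has_field_derivative_def A_def linear_scale[OF linear_hess]
            mult_commute_abs flip: scaleR_add_right)
    moreover have "0 < d \<bullet> (d + A d)"
      using inner_hess_pos[OF interior_triangle_N_cot_pos[OF lt], of d] pq
      by (simp add: A_def inner_add_right d_def add_nonneg_pos)
    ultimately show "\<exists>y. (\<phi> has_real_derivative y) (at t) \<and> 0 < y" by blast
  qed simp
  with eq show False by (simp add: \<phi>_def l_def d_def)
qed

lemma H_sigma_eq:
  assumes "p \<in> interior triangle_N"
  shows "H_sigma (cnj (p + grad surface_tension p)) = p - grad surface_tension p"
  unfolding H_sigma_def complex_cnj_cnj Let_def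
  by (simp add: the_inv_into_f_f[OF inj_on_id_plus_grad_surface_tension assms])

text \<open>The real chain rule gives the derivative \<open>B (cnj w) - A (B (cnj w))\<close>, where
  \<open>B\<close> inverts \<open>v + A v\<close>. That it is multiplication by a complex number,
  hence a complex derivative, is \<open>hess_ratio\<close>.\<close>

lemma DERIV_H_sigma:
  assumes p: "p \<in> interior triangle_N"
    and Y: "Y = (of_real (cot (pi * Im p)) - \<i>) / of_real (cot (pi * Re p) + cot (pi * Im p))"
  shows "(H_sigma has_field_derivative - ((\<i> + (1 - \<i>) * Y) / (\<i> - (1 + \<i>) * Y)))
           (at (cnj (p + grad surface_tension p)))"
proof -
  define F where "F = (\<lambda>p. p + grad surface_tension p)"
  define K where "K = the_inv_into (interior triangle_N) F"
  define A where "A = hess (cot (pi * Re p)) (cot (pi * Im p))"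
  have T: "0 < cot (pi * Re p) + cot (pi * Im p)" by (rule interior_triangle_N_cot_pos[OF p])
  have F: "(F has_derivative (\<lambda>v. v + hess (cot (pi * Re p)) (cot (pi * Im p)) v)) (at p)"
    if "p \<in> interior triangle_N" for p
    unfolding F_def by (intro has_derivative_add has_derivative_ident has_derivative_grad_surface_tension that)
  have KF: "K (F x) = x" if "x \<in> interior triangle_N" for x
    unfolding K_def F_def by (rule the_inv_into_f_f[OF inj_on_id_plus_grad_surface_tension that])
  have lin: "linear (\<lambda>v. v + A v)"
    unfolding A_def by (intro linear_compose_add linear_ident linear_hess)
  have "v + A v \<noteq> 0" if "v \<noteq> 0" for v
  proof
    assume "v + A v = 0"
    then have "v \<bullet> (v + A v) = 0" by simp
    moreover have "0 < v \<bullet> (v + A v)"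
      using inner_hess_pos[OF T that] that by (simp add: A_def inner_add_right add_nonneg_pos)
    ultimately show False by simp
  qed
  then have "inj (\<lambda>v. v + A v)" using linear_injective_0[OF lin] by blast
  then obtain B where B: "\<And>w. B w + A (B w) = w"
    using linear_injective_isomorphism[OF lin] by blast
  \<comment> \<open>Inverse function theorem: \<open>F\<close> is continuous on the open interior,
    \<open>K\<close> is a left inverse there, and the derivative of \<open>F\<close> at
    \<open>p\<close> is invertible.\<close>
  have "(K has_derivative B) (at (F p))"
  proof (rule has_derivative_inverse_strong[where S = "interior triangle_N" and f = F and x = p])
    show "continuous_on (interior triangle_N) F"
      by (meson F continuous_at_imp_continuous_on has_derivative_continuous)
    show "(F has_derivative (\<lambda>v. v + A v)) (at p)" unfolding A_def by (rule F[OF p])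
    show "(\<lambda>v. v + A v) \<circ> B = id" using B by (simp add: fun_eq_iff)
  qed (use p KF in auto)
  then have "(K has_derivative B) (at (cnj (cnj (F p))))" by simp
  from has_derivative_compose[OF bounded_linear_imp_has_derivative[OF bounded_linear_cnj] this]
  have K: "((\<lambda>w. K (cnj w)) has_derivative (\<lambda>w. B (cnj w))) (at (cnj (F p)))" .
  have "(grad surface_tension has_derivative A) (at (K (cnj (cnj (F p)))))"
    using has_derivative_grad_surface_tension[OF p] KF[OF p] by (simp add: A_def)
  from has_derivative_diff[OF K has_derivative_compose[OF K this]]
  have "(H_sigma has_derivative (\<lambda>w. B (cnj w) - A (B (cnj w)))) (at (cnj (F p)))"
    by (simp add: H_sigma_def[abs_def] Let_def K_def F_def)
  \<comment> \<open>For \<open>v = B (cnj w)\<close> one has \<open>v + A v = cnj w\<close>, whose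
    conjugate is \<open>w\<close>.\<close>
  also have "(\<lambda>w. B (cnj w) - A (B (cnj w))) = (*) (- ((\<i> + (1 - \<i>) * Y) / (\<i> - (1 + \<i>) * Y)))"
    using hess_ratio[OF T Y, of "B (cnj _)", folded A_def] by (simp only: B complex_cnj_cnj fun_eq_iff simp_thms)
  finally show ?thesis
    by (simp only: has_field_derivative_def F_def)
qed

section \<open>Cotangent form of \<open>Upsilon\<close> and \<open>Omega_fun\<close>, and the
  conclusion\<close>

text \<open>The phases are \<open>cis (- b) = sin b * (Z - \<i>)\<close> and
  \<open>cis a = sin a * (X + \<i>)\<close>; the remaining sine quotient is
  \<open>1 / (X + Z)\<close> in both cases.\<close>

lemma Upsilon_Omega_cot:
  assumes p: "grad h z \<in> interior triangle_N"
  defines "X \<equiv> cot (pi * Re (grad h z))" and "Z \<equiv> cot (pi * Im (grad h z))"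
  shows "Upsilon h z = (of_real Z - \<i>) / of_real (X + Z)"
    and "Omega_fun h z = (of_real X + \<i>) / of_real (X + Z)"
proof -
  define a b where "a = pi * Re (grad h z)" and "b = pi * Im (grad h z)"
  have pos: "0 < sin a" "0 < sin b" "0 < sin (a + b)"
    using interior_triangle_N_sin_pos[OF p] by (simp_all add: a_def b_def distrib_left)
  have T: "X + Z = sin (a + b) / (sin a * sin b)"
    using pos by (simp add: X_def Z_def a_def[symmetric] b_def[symmetric] cot_add)
  have pd: "pi * pdx h z = a" "pi * pdy h z = b" by (simp_all add: a_def b_def grad_def)
  have "pi * pdx surface_tension (grad h z) = ln (sin a / sin (a + b))"
    "pi * pdy surface_tension (grad h z) = ln (sin b / sin (a + b))"
    using pos by (simp_all add: pd_surface_tension[OF p] ln_div a_def b_def distrib_left)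
  then have "exp (of_real (pi * pdx surface_tension (grad h z))) = (of_real (sin a / sin (a + b)) :: complex)"
    "exp (of_real (pi * pdy surface_tension (grad h z))) = (of_real (sin b / sin (a + b)) :: complex)"
    using pos by (simp_all only: exp_of_real exp_ln divide_pos_pos)
  then have "Upsilon h z = of_real (sin a / sin (a + b)) * cis (- b)"
    "Omega_fun h z = of_real (sin b / sin (a + b)) * cis a"
    by (simp_all add: Upsilon_def Omega_fun_def exp_add exp_diff exp_minus pd cis_conv_exp divide_inverse)
  then show "Upsilon h z = (of_real Z - \<i>) / of_real (X + Z)"
    "Omega_fun h z = (of_real X + \<i>) / of_real (X + Z)"
    using pos unfolding T
    by (simp_all add: complex_eq_iff X_def Z_def cot_def field_simps flip: a_def b_def)
qed

theorem proposition5p1p1: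
  fixes P :: "complex set" and u0 h :: "complex \<Rightarrow> real"
    and S :: real and q \<kappa> :: complex
  assumes "bounded_lipschitz_domain P"
    and "u0 \<in> admissible P"
    and "q \<noteq> 0"
    and "\<forall>z\<in>P. qvol_denom S q \<kappa> z \<noteq> 0"
    and "\<forall>z\<in>P. qvol_weight S q \<kappa> z \<in> \<real>"
    and "unique_minimizer P u0 (\<lambda>z. Re (qvol_weight S q \<kappa> z)) h"
  shows "\<forall>z\<in>liquid_region P h.
    (let f = f_map h z; Y = Upsilon h z; W = Omega_fun h z in
       Y + W = 1 \<and>
       f \<in> H_sigma_dom \<and>
       (H_sigma has_field_derivative - ((\<i> + (1 - \<i>) * Y) / (\<i> - (1 + \<i>) * Y))) (at f) \<and>
       - ((\<i> + (1 - \<i>) * Y) / (\<i> - (1 + \<i>) * Y)) = - ((1 + (\<i> - 1) * W) / (- 1 + (1 + \<i>) * W)) \<and>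
       Y = exp (of_real pi / 2 * (f - H_sigma f)) \<and>
       W = exp (\<i> * (of_real pi / 2) * (f + H_sigma f)))"
proof
  fix z assume "z \<in> liquid_region P h"
  then have p: "grad h z \<in> interior triangle_N" by (simp add: liquid_region_def)
  define f Y W where "f = f_map h z" and "Y = Upsilon h z" and "W = Omega_fun h z"
  have T: "0 < cot (pi * Re (grad h z)) + cot (pi * Im (grad h z))"
    by (rule interior_triangle_N_cot_pos[OF p])
  have sum: "Y + W = 1"
    using T unfolding Y_def W_def Upsilon_Omega_cot[OF p]
    by (simp add: add_divide_distrib[symmetric] complex_eq_iff)
  have H: "H_sigma f = grad h z - grad surface_tension (grad h z)"
    unfolding f_def f_map_def by (rule H_sigma_eq[OF p])
  have "f \<in> H_sigma_dom"
    using p by (auto simp: H_sigma_dom_def f_def f_map_def)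
  moreover have "(H_sigma has_field_derivative - ((\<i> + (1 - \<i>) * Y) / (\<i> - (1 + \<i>) * Y))) (at f)"
    unfolding f_def f_map_def Y_def by (rule DERIV_H_sigma[OF p Upsilon_Omega_cot(1)[OF p]])
  \<comment> \<open>Substituting \<open>Y = 1 - W\<close> matches numerators and denominators
    separately.\<close>
  moreover have "\<i> + (1 - \<i>) * Y = 1 + (\<i> - 1) * W" "\<i> - (1 + \<i>) * Y = - 1 + (1 + \<i>) * W"
    using sum by algebra+
  \<comment> \<open>With \<open>p\<close> the gradient of \<open>h\<close> and \<open>g\<close> that
    of the surface tension at \<open>p\<close>, \<open>f - H_sigma f\<close> is
    \<open>2 * Re g - 2 * \<i> * Im p\<close>, and \<open>f + H_sigma f\<close> is
    \<open>2 * Re p - 2 * \<i> * Im g\<close>.\<close>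
  moreover have "Y = exp (of_real pi / 2 * (f - H_sigma f))"
    unfolding Y_def Upsilon_def H unfolding f_def f_map_def
    by (rule arg_cong[of _ _ exp]) (simp add: complex_eq_iff grad_def)
  moreover have "W = exp (\<i> * (of_real pi / 2) * (f + H_sigma f))"
    unfolding W_def Omega_fun_def H unfolding f_def f_map_def
    by (rule arg_cong[of _ _ exp]) (simp add: complex_eq_iff grad_def)
  ultimately show "let f = f_map h z; Y = Upsilon h z; W = Omega_fun h z in
       Y + W = 1 \<and>
       f \<in> H_sigma_dom \<and>
       (H_sigma has_field_derivative - ((\<i> + (1 - \<i>) * Y) / (\<i> - (1 + \<i>) * Y))) (at f) \<and>
       - ((\<i> + (1 - \<i>) * Y) / (\<i> - (1 + \<i>) * Y)) = - ((1 + (\<i> - 1) * W) / (- 1 + (1 + \<i>) * W)) \<and>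
       Y = exp (of_real pi / 2 * (f - H_sigma f)) \<and>
       W = exp (\<i> * (of_real pi / 2) * (f + H_sigma f))"
    unfolding Let_def f_def[symmetric] Y_def[symmetric] W_def[symmetric]
    using sum by simp
qed

end
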